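(* Let $N=\{1,\dots,n\}$ and let $\mathbf{k}=(k_1,\dots,k_n)$ be a given target degree sequence (an $n$-tuple of nonnegative integers, not assumed to be realized by any graph). Let $(\mathbf{x},\boldsymbol{\psi},\mathbf{e})$ be an optimal solution of the following integer linear program, with variables $x_{ij},\psi_{ij}$ for ordered pairs $(i,j)$, $i\neq j$, and real variables $e_i$ for $i\in N$: $$ \begin{aligned} \min\ & \sum_{i} e_i\\ \text{s.t. } & \sum_{j\neq i} x_{ij}-k_i\le e_i \quad \forall i,\\ & -\sum_{j\neq i} x_{ij}+k_i\le e_i \quad \forall i,\\ & \psi_{ij}+\psi_{ji}-1\le x_{ij}\quad \forall i\ne j,\\ & x_{ij}\le \psi_{ij}\quad \forall i\neq j,\\ & x_{ij}\le \psi_{ji}\quad \forall i\neq j,\\ & x_{ij}-x_{ji}=0\quad \forall i<j,\\ & x_{ij},\psi_{ij}\in\{0,1\}\quad \forall i\neq j. \end{aligned} $$ Let $\mathbf{C}=(c_{ij})_{i\neq j}$ be any real cost matrix derived from $\boldsymbol{\psi}$, i.e. satisfying $c_{ij}<0$ if $\psi_{ij}=1$ and $c_{ij}\ge 0$ if $\psi_{ij}=0$ (for example, $c_{ij}=-1$ if $\psi_{ij}=1$ and $c_{ij}=1$ if $\psi_{ij}=0$). Then the graph formation game with cost matrix $\mathbf{C}$ admits a pairwise stable graph $g$ on $N$ whose degree sequence $(d_1(g),\dots,d_n(g))$ is as close as possible to $\mathbf{k}$ in the $\ell_1$ metric, i.e. $\sum_i |d_i(g)-k_i|\le \sum_i|d_i(h)-k_i|$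 for every graph $h$ on $N$.
   Context: A link is a 2-element subset $ij=\{i,j\}$ of $N=\{1,\dots,n\}$; a graph $g$ on $N$ is any set of links, and $d_i(g)$ is the number of links of $g$ containing $i$. For a graph $g$, put $x_{ij}=1$ if $ij\in g$ and $x_{ij}=0$ otherwise (so $x_{ij}=x_{ji}$); a graph is identified with the vector $\mathbf{x}=\langle x_{ij}\rangle$. In the graph formation game (with link bias) with real cost matrix $\mathbf{C}=(c_{ij})_{i\neq j}$, the players are the nodes, player $i$ has cost $f_i(g)=\sum_{j\ne i}c_{ij}x_{ij}$, and the value allocated to player $i$ is $Y_i(g)=-f_i(g)$. A link exists only if both its endpoints agree to it, and link parsimony is assumed: a link is established if and only if both players strictly benefit from it. Accordingly, a graph $g$ is pairwise stable for the game with cost matrix $\mathbf{C}$ if and only if: (1) for all $ij\in g$, $c_{ij}<0$ and $c_{ji}<0$; and (2) for all $ij\notin g$, if $c_{ij}<0$ then $c_{ji}\ge 0$. *)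

theory Defs
  imports Complex_Main
begin

definition nodes :: "nat \<Rightarrow> nat set" where
  "nodes n = {1..n}"

definition links :: "nat \<Rightarrow> nat set set" where
  "links n = {l. l \<subseteq> nodes n \<and> card l = 2}"

definition is_graph :: "nat \<Rightarrow> nat set set \<Rightarrow> bool" where
  "is_graph n g \<longleftrightarrow> g \<subseteq> links n"

definition deg :: "nat set set \<Rightarrow> nat \<Rightarrow> nat" where
  "deg g i = card {l \<in> g. i \<in> l}"

definition degree_dist :: "nat \<Rightarrow> (nat \<Rightarrow> nat) \<Rightarrow> nat set set \<Rightarrow> real" where
  "degree_dist n k g = (\<Sum>i\<in>nodes n. \<bar>real (deg g i) - real (k i)\<bar>)"

definition adj :: "nat set set \<Rightarrow> nat \<Rightarrow> nat \<Rightarrow> real" where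
  "adj g i j = (if {i, j} \<in> g then 1 else 0)"

definition player_cost :: "nat \<Rightarrow> (nat \<Rightarrow> nat \<Rightarrow> real) \<Rightarrow> nat set set \<Rightarrow> nat \<Rightarrow> real" where
  "player_cost n c g i = (\<Sum>j\<in>nodes n - {i}. c i j * adj g i j)"

definition payoff :: "nat \<Rightarrow> (nat \<Rightarrow> nat \<Rightarrow> real) \<Rightarrow> nat set set \<Rightarrow> nat \<Rightarrow> real" where
  "payoff n c g i = - player_cost n c g i"

text \<open>Stability under link parsimony, expressed on the cost matrix; its reading in terms of
  payoffs is the lemma \<open>pairwise_stable_iff_payoff\<close> below. Diagonal entries of matrices
  are never consulted.\<close>

definition pairwise_stable :: "nat \<Rightarrow> (nat \<Rightarrow> nat \<Rightarrow> real) \<Rightarrow> nat set set \<Rightarrow> bool" where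
  "pairwise_stable n c g \<longleftrightarrow>
     (\<forall>i\<in>nodes n. \<forall>j\<in>nodes n. i \<noteq> j \<longrightarrow> {i, j} \<in> g \<longrightarrow> c i j < 0 \<and> c j i < 0) \<and>
     (\<forall>i\<in>nodes n. \<forall>j\<in>nodes n. i \<noteq> j \<longrightarrow> {i, j} \<notin> g \<longrightarrow> c i j < 0 \<longrightarrow> c j i \<ge> 0)"

lemma payoff_insert_link:
  assumes "i \<in> nodes n" "j \<in> nodes n" "i \<noteq> j" "{i, j} \<notin> g"
  shows "payoff n c (insert {i, j} g) i = payoff n c g i - c i j"
proof -
  have fin: "finite (nodes n - {i})" by (simp add: nodes_def)
  have j: "j \<in> nodes n - {i}" using assms by simp
  have rest: "(\<Sum>m\<in>nodes n - {i} - {j}. c i m * adj (insert {i, j} g) i m)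
      = (\<Sum>m\<in>nodes n - {i} - {j}. c i m * adj g i m)"
    by (rule sum.cong) (auto simp: adj_def doubleton_eq_iff)
  show ?thesis
    unfolding payoff_def player_cost_def sum.remove[OF fin j] rest
    using assms by (simp add: adj_def)
qed

lemma pairwise_stable_iff_payoff:
  "pairwise_stable n c g \<longleftrightarrow>
     (\<forall>i\<in>nodes n. \<forall>j\<in>nodes n. i \<noteq> j \<longrightarrow> {i, j} \<in> g \<longrightarrow>
        payoff n c g i > payoff n c (g - {{i, j}}) i \<and>
        payoff n c g j > payoff n c (g - {{i, j}}) j) \<and>
     (\<forall>i\<in>nodes n. \<forall>j\<in>nodes n. i \<noteq> j \<longrightarrow> {i, j} \<notin> g \<longrightarrow>
        payoff n c (insert {i, j} g) i > payoff n c g i \<longrightarrow>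
        payoff n c (insert {i, j} g) j \<le> payoff n c g j)"
proof -
  have add_i: "payoff n c (insert {i, j} g) i = payoff n c g i - c i j"
    and add_j: "payoff n c (insert {i, j} g) j = payoff n c g j - c j i"
    if "i \<in> nodes n" "j \<in> nodes n" "i \<noteq> j" "{i, j} \<notin> g" for i j
    using payoff_insert_link[of i n j g c] payoff_insert_link[of j n i g c] that
    by (auto simp: insert_commute)
  have del_i: "payoff n c g i = payoff n c (g - {{i, j}}) i - c i j"
    and del_j: "payoff n c g j = payoff n c (g - {{i, j}}) j - c j i"
    if "i \<in> nodes n" "j \<in> nodes n" "i \<noteq> j" "{i, j} \<in> g" for i j
    using payoff_insert_link[of i n j "g - {{i, j}}" c]
      payoff_insert_link[of j n i "g - {{i, j}}" c] that
    by (auto simp: insert_commute insert_absorb)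
  have del: "(payoff n c g i > payoff n c (g - {{i, j}}) i \<and>
        payoff n c g j > payoff n c (g - {{i, j}}) j) \<longleftrightarrow> c i j < 0 \<and> c j i < 0"
    if "i \<in> nodes n" "j \<in> nodes n" "i \<noteq> j" "{i, j} \<in> g" for i j
    using del_i[OF that] del_j[OF that] by linarith
  have add: "(payoff n c (insert {i, j} g) i > payoff n c g i \<longrightarrow>
        payoff n c (insert {i, j} g) j \<le> payoff n c g j) \<longleftrightarrow> (c i j < 0 \<longrightarrow> c j i \<ge> 0)"
    if "i \<in> nodes n" "j \<in> nodes n" "i \<noteq> j" "{i, j} \<notin> g" for i j
    using add_i[OF that] add_j[OF that] by linarith
  show ?thesis
    unfolding pairwise_stable_def using del add by (smt (verit))
qed

definition ilp_feasible ::
  "nat \<Rightarrow> (nat \<Rightarrow> nat) \<Rightarrow> (nat \<Rightarrow> nat \<Rightarrow> real) \<Rightarrow> (nat \<Rightarrow> nat \<Rightarrow> real) \<Rightarrow> (nat \<Rightarrow> real) \<Rightarrow> bool" where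
  "ilp_feasible n k x \<psi> e \<longleftrightarrow>
     (\<forall>i\<in>nodes n. (\<Sum>j\<in>nodes n - {i}. x i j) - real (k i) \<le> e i) \<and>
     (\<forall>i\<in>nodes n. - (\<Sum>j\<in>nodes n - {i}. x i j) + real (k i) \<le> e i) \<and>
     (\<forall>i\<in>nodes n. \<forall>j\<in>nodes n. i \<noteq> j \<longrightarrow> \<psi> i j + \<psi> j i - 1 \<le> x i j) \<and>
     (\<forall>i\<in>nodes n. \<forall>j\<in>nodes n. i \<noteq> j \<longrightarrow> x i j \<le> \<psi> i j) \<and>
     (\<forall>i\<in>nodes n. \<forall>j\<in>nodes n. i \<noteq> j \<longrightarrow> x i j \<le> \<psi> j i) \<and>
     (\<forall>i\<in>nodes n. \<forall>j\<in>nodes n. i < j \<longrightarrow> x i j - x j i = 0) \<and>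
     (\<forall>i\<in>nodes n. \<forall>j\<in>nodes n. i \<noteq> j \<longrightarrow> x i j \<in> {0, 1} \<and> \<psi> i j \<in> {0, 1})"

definition ilp_optimal ::
  "nat \<Rightarrow> (nat \<Rightarrow> nat) \<Rightarrow> (nat \<Rightarrow> nat \<Rightarrow> real) \<Rightarrow> (nat \<Rightarrow> nat \<Rightarrow> real) \<Rightarrow> (nat \<Rightarrow> real) \<Rightarrow> bool" where
  "ilp_optimal n k x \<psi> e \<longleftrightarrow>
     ilp_feasible n k x \<psi> e \<and>
     (\<forall>x' \<psi>' e'. ilp_feasible n k x' \<psi>' e' \<longrightarrow> (\<Sum>i\<in>nodes n. e i) \<le> (\<Sum>i\<in>nodes n. e' i))"

definition cost_derived_from ::
  "nat \<Rightarrow> (nat \<Rightarrow> nat \<Rightarrow> real) \<Rightarrow> (nat \<Rightarrow> nat \<Rightarrow> real) \<Rightarrow> bool" where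
  "cost_derived_from n \<psi> c \<longleftrightarrow>
     (\<forall>i\<in>nodes n. \<forall>j\<in>nodes n. i \<noteq> j \<longrightarrow>
        (\<psi> i j = 1 \<longrightarrow> c i j < 0) \<and> (\<psi> i j = 0 \<longrightarrow> c i j \<ge> 0))"

end

theory Submission
  imports Defs
begin

text \<open>Every graph \<open>h\<close> yields a feasible point with \<open>x = \<psi> = adj h\<close> and
  \<open>e i = \<bar>deg h i - k i\<bar>\<close>, so the optimal value is at most the distance of any graph from \<open>k\<close>.
  Conversely, the links with \<open>x i j = 1\<close> form a graph whose distance is at most the objective
  value. The constraints linking \<open>x\<close> and \<open>\<psi>\<close> say that \<open>x i j = 1\<close> iff
  \<open>\<psi> i j = \<psi> j i = 1\<close>, which is pairwise stability.\<close>

text \<open>Each link at \<open>i\<close> is \<open>{i, j}\<close> for exactly one neighbour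
  \<open>j\<close>, so counting links at \<open>i\<close> amounts to counting neighbours.\<close>

lemma deg_eq_sum_adj:
  assumes "is_graph n g" and i: "i \<in> nodes n"
  shows "real (deg g i) = (\<Sum>j\<in>nodes n - {i}. adj g i j)"
proof -
  let ?J = "{j \<in> nodes n - {i}. {i, j} \<in> g}"
  have "{l \<in> g. i \<in> l} = (\<lambda>j. {i, j}) ` ?J"
  proof (intro equalityI subsetI)
    fix l assume l: "l \<in> {l \<in> g. i \<in> l}"
    then have "l \<subseteq> nodes n" "card l = 2"
      using assms by (auto simp: is_graph_def links_def)
    with l obtain j where "l = {i, j}" "i \<noteq> j"
      by (auto simp: card_2_iff insert_commute)
    with l \<open>l \<subseteq> nodes n\<close> show "l \<in> (\<lambda>j. {i, j}) ` ?J" by auto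
  qed auto
  moreover have "inj_on (\<lambda>j. {i, j}) ?J"
    by (auto simp: inj_on_def doubleton_eq_iff)
  ultimately have "deg g i = card ?J"
    by (simp add: deg_def card_image)
  also have "real \<dots> = (\<Sum>j\<in>nodes n - {i}. adj g i j)"
    by (simp add: adj_def sum.If_cases nodes_def Int_def)
  finally show ?thesis .
qed

lemma ilp_feasible_adj:
  assumes "is_graph n h"
  shows "ilp_feasible n k (adj h) (adj h) (\<lambda>i. \<bar>real (deg h i) - real (k i)\<bar>)"
  unfolding ilp_feasible_def
  \<comment> \<open>Once the sums are folded into degrees, the two constraints on \<open>e\<close>
    bound t and -t by \<bar>t\<bar>.\<close>
  by (simp add: deg_eq_sum_adj[OF assms, symmetric]) (auto simp: adj_def insert_commute)

definition graph_of :: "nat \<Rightarrow> (nat \<Rightarrow> nat \<Rightarrow> real) \<Rightarrow> nat set set" where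
  "graph_of n x = {{i, j} | i j. i \<in> nodes n \<and> j \<in> nodes n \<and> i \<noteq> j \<and> x i j = 1}"

lemma is_graph_graph_of: "is_graph n (graph_of n x)"
  by (auto simp: is_graph_def links_def graph_of_def)

text \<open>The program imposes symmetry only for i < j; swapping the indices gives the other
  order.\<close>

lemma ilp_feasible_sym:
  assumes "ilp_feasible n k x \<psi> e" "i \<in> nodes n" "j \<in> nodes n"
  shows "x i j = x j i"
  using assms unfolding ilp_feasible_def
  by (metis eq_iff_diff_eq_0 linorder_neqE_nat)

text \<open>Since \<open>{i, j} = {j, i}\<close>, membership may be witnessed by
  \<open>x j i = 1\<close>; symmetry of \<open>x\<close> turns this into
  \<open>x i j = 1\<close>.\<close>

lemma link_graph_of_iff:
  assumes "ilp_feasible n k x \<psi> e" "i \<in> nodes n" "j \<in> nodes n" "i \<noteq> j"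
  shows "{i, j} \<in> graph_of n x \<longleftrightarrow> x i j = 1"
  using assms ilp_feasible_sym[OF assms(1-3)]
  by (auto simp: graph_of_def doubleton_eq_iff)

lemma ilp_feasible_binary:
  assumes "ilp_feasible n k x \<psi> e" "i \<in> nodes n" "j \<in> nodes n" "i \<noteq> j"
  shows "x i j = 0 \<or> x i j = 1" "\<psi> i j = 0 \<or> \<psi> i j = 1"
  using assms by (simp_all add: ilp_feasible_def)

lemma ilp_feasible_link_iff:
  assumes "ilp_feasible n k x \<psi> e" "i \<in> nodes n" "j \<in> nodes n" "i \<noteq> j"
  shows "x i j = 1 \<longleftrightarrow> \<psi> i j = 1 \<and> \<psi> j i = 1"
proof -
  have "\<psi> i j + \<psi> j i - 1 \<le> x i j" "x i j \<le> \<psi> i j" "x i j \<le> \<psi> j i"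
    using assms by (simp_all add: ilp_feasible_def)
  then show ?thesis
    using ilp_feasible_binary[OF assms] ilp_feasible_binary(2)[OF assms(1,3,2)] assms(4) by auto
qed

lemma degree_dist_graph_of_le:
  assumes feas: "ilp_feasible n k x \<psi> e"
  shows "degree_dist n k (graph_of n x) \<le> (\<Sum>i\<in>nodes n. e i)"
  unfolding degree_dist_def
proof (rule sum_mono)
  fix i assume i: "i \<in> nodes n"
  have "real (deg (graph_of n x) i) = (\<Sum>j\<in>nodes n - {i}. x i j)"
    unfolding deg_eq_sum_adj[OF is_graph_graph_of i]
    \<comment> \<open>As \<open>x\<close> is binary, it is 0 wherever there is no link, and so
      agrees with the adjacency values.\<close>
    using link_graph_of_iff[OF feas i] ilp_feasible_binary(1)[OF feas i]
    by (intro sum.cong) (auto simp: adj_def)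
  moreover have "(\<Sum>j\<in>nodes n - {i}. x i j) - real (k i) \<le> e i"
      "- (\<Sum>j\<in>nodes n - {i}. x i j) + real (k i) \<le> e i"
    using feas i by (simp_all add: ilp_feasible_def)
  ultimately show "\<bar>real (deg (graph_of n x) i) - real (k i)\<bar> \<le> e i"
    by linarith
qed

lemma pairwise_stable_graph_of:
  assumes feas: "ilp_feasible n k x \<psi> e" and cost: "cost_derived_from n \<psi> c"
  shows "pairwise_stable n c (graph_of n x)"
proof -
  \<comment> \<open>Deriving \<open>c\<close> from \<open>\<psi>\<close> gives two implications;
    they combine to an equivalence because \<open>\<psi>\<close> is binary.\<close>
  have neg_iff: "c i j < 0 \<longleftrightarrow> \<psi> i j = 1"
    if "i \<in> nodes n" "j \<in> nodes n" "i \<noteq> j" for i j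
  proof -
    have "\<psi> i j = 1 \<Longrightarrow> c i j < 0" "\<psi> i j = 0 \<Longrightarrow> 0 \<le> c i j"
      using cost that unfolding cost_derived_from_def by blast+
    then show ?thesis
      using ilp_feasible_binary(2)[OF feas that] by auto
  qed
  \<comment> \<open>This equivalence contains both stability conditions: one per direction.\<close>
  have "{i, j} \<in> graph_of n x \<longleftrightarrow> c i j < 0 \<and> c j i < 0"
    if "i \<in> nodes n" "j \<in> nodes n" "i \<noteq> j" for i j
    using link_graph_of_iff[OF feas that] ilp_feasible_link_iff[OF feas that]
      neg_iff[OF that] neg_iff[of j i] that by auto
  then show ?thesis
    unfolding pairwise_stable_def by (meson not_less)
qed

theorem theorem7:
  fixes n :: nat
    and k :: "nat \<Rightarrow> nat"
    and x \<psi> c :: "nat \<Rightarrow> nat \<Rightarrow> real"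
    and e :: "nat \<Rightarrow> real"
  assumes "ilp_optimal n k x \<psi> e"
    and "cost_derived_from n \<psi> c"
  shows "\<exists>g. is_graph n g \<and> pairwise_stable n c g \<and>
           (\<forall>h. is_graph n h \<longrightarrow> degree_dist n k g \<le> degree_dist n k h)"
proof (intro exI[of _ "graph_of n x"] conjI allI impI)
  have feas: "ilp_feasible n k x \<psi> e"
    using assms(1) by (simp add: ilp_optimal_def)
  show "is_graph n (graph_of n x)" by (rule is_graph_graph_of)
  show "pairwise_stable n c (graph_of n x)"
    using feas assms(2) by (rule pairwise_stable_graph_of)
  fix h assume "is_graph n h"
  \<comment> \<open>Optimality is compared with the feasible point built from \<open>h\<close>,
    whose objective value is the distance of \<open>h\<close>.\<close>
  then have "(\<Sum>i\<in>nodes n. e i) \<le> degree_dist n k h"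
    using assms(1) ilp_feasible_adj unfolding ilp_optimal_def degree_dist_def by blast
  with degree_dist_graph_of_le[OF feas]
  show "degree_dist n k (graph_of n x) \<le> degree_dist n k h" by linarith
qed

end
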